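(* Let $G = C_{\ell_1} \sqcup C_{\ell_2} \sqcup C_{\ell_3}$ be the disjoint union of three cycles with lengths $\ell_j \equiv 1 \pmod{3}$, $\ell_j \ge 4$ for $1 \le j \le 3$. Then there exists a partition $\mathcal{P} = \{V_1, \ldots, V_r\}$ of $V(G)$ such that $|V_i| = 3$ for every $i$ and $G$ has no independent transversal with respect to $\mathcal{P}$.
   Context: $C_\ell$ denotes the cycle with $\ell$ vertices. For a graph $G$ and a partition $\mathcal{P} = \{V_1, \ldots, V_r\}$ of $V(G)$ into blocks, an independent transversal (IT) of $G$ with respect to $\mathcal{P}$ is an independent set $\{v_1, \ldots, v_r\}$ of $G$ with $v_i \in V_i$ for every $i \in \{1,\ldots,r\}$. *)

theory Defs
  imports "HOL-Library.Disjoint_Sets" "HOL-Library.Ramsey"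
begin

type_synonym 'a graph = "'a set \<times> 'a set set"

definition verts :: "'a graph \<Rightarrow> 'a set" where
  "verts G = fst G"

definition edges :: "'a graph \<Rightarrow> 'a set set" where
  "edges G = snd G"

definition simple_graph :: "'a graph \<Rightarrow> bool" where
  "simple_graph G \<longleftrightarrow> finite (verts G) \<and> (\<forall>e\<in>edges G. e \<subseteq> verts G \<and> card e = 2)"

(* Meaningful for n \<ge> 3 only; for n = 1 the edge degenerates to a singleton,
   for n = 2 the two edges coincide. *)
definition cycle_graph :: "nat \<Rightarrow> nat graph" where
  "cycle_graph n = ({0..<n}, {{i, (i + 1) mod n} | i. i < n})"

definition disjoint_union :: "'i set \<Rightarrow> ('i \<Rightarrow> 'a graph) \<Rightarrow> ('i \<times> 'a) graph" where
  "disjoint_union I G =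
     (Sigma I (\<lambda>j. verts (G j)), {Pair j ` e | j e. j \<in> I \<and> e \<in> edges (G j)})"

definition independent_set :: "'a graph \<Rightarrow> 'a set \<Rightarrow> bool" where
  "independent_set G S \<longleftrightarrow> S \<subseteq> verts G \<and> indep S (edges G)"

(* The blocks index themselves: v B is the vertex chosen from the block B. *)
definition independent_transversal :: "'a graph \<Rightarrow> 'a set set \<Rightarrow> 'a set \<Rightarrow> bool" where
  "independent_transversal G P S \<longleftrightarrow>
     independent_set G S \<and> (\<exists>v. (\<forall>B\<in>P. v B \<in> B) \<and> S = v ` P)"

lemma simple_graph_cycle_graph:
  assumes "n \<ge> 3"
  shows "simple_graph (cycle_graph n)"
proof -
  have "i \<noteq> Suc i mod n" if "i < n" for i
    using that assms by (cases "Suc i = n") auto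
  then show ?thesis
    using assms by (auto simp: simple_graph_def cycle_graph_def verts_def edges_def card_2_iff)
qed

lemma simple_graph_disjoint_union:
  assumes "finite I" "\<And>j. j \<in> I \<Longrightarrow> simple_graph (G j)"
  shows "simple_graph (disjoint_union I G)"
proof -
  have "card (Pair j ` e) = card e" for j :: 'a and e :: "'b set"
    by (simp add: card_image inj_on_def)
  then show ?thesis
    using assms by (fastforce simp: simple_graph_def disjoint_union_def verts_def edges_def)
qed

end

theory Submission
  imports Defs
begin

text \<open>Subdividing an edge \<open>uv\<close> three times, into a path \<open>u x y z v\<close>, preserves the absence of an
  independent transversal: put \<open>z\<close> in place of \<open>u\<close> and \<open>x\<close> in place of \<open>v\<close> in the old blocks and add
  the block \<open>{u, y, v}\<close>. An independent transversal of the new graph contains exactly one of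
  \<open>u, y, v\<close>; choosing \<open>y\<close> excludes \<open>x\<close> and \<open>z\<close>, choosing \<open>u\<close> excludes \<open>x\<close>, and choosing \<open>v\<close>
  excludes \<open>z\<close>. In each case undoing the replacement yields an independent transversal of the old
  graph. By induction this reduces the theorem to three 4-cycles. There, two of the cycles are
  split into pairs of opposite vertices, and the four vertices of the third cycle complete these
  pairs to triples, so that the pairs of one cycle get opposite vertices of the third. The pairs of
  one cycle cannot both be met, so one of these opposite vertices is chosen; the same
  holds for the other cycle, and this gives two adjacent vertices of the third.\<close>

section \<open>Threefold subdivision of an edge\<close>

definition triple_partition_without_IT :: "'a graph \<Rightarrow> 'a set set \<Rightarrow> bool" where
  "triple_partition_without_IT G P \<longleftrightarrow>
     partition_on (verts G) P \<and> (\<forall>B\<in>P. card B = 3) \<and> \<not> (\<exists>S. independent_transversal G P S)"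

lemma independent_transversalE:
  assumes "independent_transversal G P S"
  obtains f where "\<And>B. B \<in> P \<Longrightarrow> f B \<in> B" "S = f ` P"
    "\<And>a b. \<lbrakk>a \<in> S; b \<in> S; a \<noteq> b\<rbrakk> \<Longrightarrow> {a, b} \<notin> edges G"
proof -
  from assms obtain f where f: "\<forall>B\<in>P. f B \<in> B" "S = f ` P" and "indep S (edges G)"
    unfolding independent_transversal_def independent_set_def by (elim conjE exE)
  show thesis
  proof (rule that[of f])
    show "{a, b} \<notin> edges G" if "a \<in> S" "b \<in> S" "a \<noteq> b" for a b
      using \<open>indep S (edges G)\<close> that by (simp add: indep_def)
  qed (use f in simp_all)
qed

text \<open>Only inclusions are asked of \<open>edges G'\<close>, since further edges can only
  destroy independent transversals.\<close>

lemma triple_partition_without_IT_subdivide: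
  assumes P: "triple_partition_without_IT G P"
    and uv: "u \<in> verts G" "v \<in> verts G" "u \<noteq> v"
    and new: "x \<notin> verts G" "y \<notin> verts G" "z \<notin> verts G" "distinct [x, y, z]"
    and verts: "verts G' = verts G \<union> {x, y, z}"
    and path: "{{u, x}, {x, y}, {y, z}, {z, v}} \<subseteq> edges G'"
    and edges: "edges G - {{u, v}} \<subseteq> edges G'"
  shows "\<exists>P'. triple_partition_without_IT G' P'"
proof -
  \<comment> \<open>The replacement is extended to an involution, swapping \<open>u\<close> with
    \<open>z\<close> and \<open>v\<close> with \<open>x\<close>: injectivity carries the partition
    over, and the same map undoes the replacement.\<close>
  define s where "s a = (if a = u then z else if a = z then u else if a = v then x
      else if a = x then v else a)" for a
  define N where "N = {u, y, v}"
  define P' where "P' = insert N ((`) s ` P)"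
  have part: "partition_on (verts G) P" and card3: "\<forall>B\<in>P. card B = 3"
    and no_IT: "\<not> independent_transversal G P S" for S
    using P by (auto simp: triple_partition_without_IT_def)
  have dist: "u \<noteq> x" "u \<noteq> y" "u \<noteq> z" "v \<noteq> x" "v \<noteq> y" "v \<noteq> z" "x \<noteq> y" "x \<noteq> z" "y \<noteq> z"
    using uv new by auto
  have s_s [simp]: "s (s a) = a" for a
    using dist uv by (auto simp: s_def)
  have inj_s: "inj s"
    by (metis injI s_s)
  have s_verts: "s ` verts G = (verts G - {u, v}) \<union> {x, z}"
  proof -
    have "a \<in> s ` verts G \<longleftrightarrow> s a \<in> verts G" for a
      by (metis imageE imageI s_s)
    then show ?thesis
      using uv new dist by (auto simp: s_def split: if_splits)
  qed
  have "{} \<notin> (`) s ` P"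
    using partition_onD3[OF part] by auto
  then have image_part: "partition_on (s ` verts G) ((`) s ` P)"
    using partition_on_inj_image[OF part inj_on_subset[OF inj_s subset_UNIV]] by simp
  have "partition_on (verts G') P'"
    unfolding P'_def
  proof (subst partition_on_insert)
    have "\<Union> ((`) s ` P) = s ` verts G"
      using partition_onD1[OF image_part] by simp
    then show "disjnt N (\<Union> ((`) s ` P))"
      unfolding s_verts N_def disjnt_def using dist uv new by auto
    have "verts G' - N = s ` verts G"
      unfolding s_verts N_def verts using dist uv new by auto
    then show "partition_on (verts G' - N) ((`) s ` P) \<and> N \<subseteq> verts G' \<and> N \<noteq> {}"
      using image_part uv verts by (auto simp: N_def)
  qed
  moreover have "\<forall>B\<in>P'. card B = 3"
    using card3 dist uv inj_s by (auto simp: P'_def N_def card_image inj_on_subset)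
  moreover have "\<not> independent_transversal G' P' S" for S
  proof
    assume "independent_transversal G' P' S"
    then obtain f where f: "\<And>B. B \<in> P' \<Longrightarrow> f B \<in> B" and S: "S = f ` P'"
      and ind: "\<And>a b. \<lbrakk>a \<in> S; b \<in> S; a \<noteq> b\<rbrakk> \<Longrightarrow> {a, b} \<notin> edges G'"
      by (rule independent_transversalE) blast
    define g where "g = (\<lambda>B. s (f (s ` B)))"
    have g: "g B \<in> B" if "B \<in> P" for B
    proof -
      have "f (s ` B) \<in> s ` B"
        using f that by (auto simp: P'_def)
      then show ?thesis
        by (auto simp: g_def)
    qed
    have old: "f (s ` B) \<in> S" "f (s ` B) \<noteq> u" "f (s ` B) \<noteq> v" if "B \<in> P" for B
    proof -
      show "f (s ` B) \<in> S"
        using that S by (auto simp: P'_def)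
      have "f (s ` B) \<in> s ` B" "s ` B \<subseteq> s ` verts G"
        using that f partition_onD1[OF part] by (auto simp: P'_def)
      then have "f (s ` B) \<in> s ` verts G"
        by blast
      then show "f (s ` B) \<noteq> u" "f (s ` B) \<noteq> v"
        unfolding s_verts using dist by auto
    qed
    have "f N \<in> N" "f N \<in> S"
      using f S by (auto simp: P'_def)
    then consider "u \<in> S" | "y \<in> S" | "v \<in> S"
      by (auto simp: N_def)
    then have sub: "g ` P \<subseteq> S \<and> \<not> {u, v} \<subseteq> g ` P"
    proof cases
      case 1
      \<comment> \<open>A pick \<open>z\<close> may still be turned into \<open>u\<close>, which is
        harmless because \<open>u\<close> is in \<open>S\<close> already.\<close>
      then have "x \<notin> S"
        using ind[of u x] path dist by auto
      then have "g B \<in> S" "g B \<noteq> v" if "B \<in> P" for B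
        using old[OF that] 1 uv dist by (auto simp: g_def s_def)
      then show ?thesis by auto
    next
      case 2
      then have "x \<notin> S" "z \<notin> S"
        using ind[of x y] ind[of y z] path dist by auto
      then have "g B \<in> S" "g B \<noteq> v" if "B \<in> P" for B
        using old[OF that] uv dist by (auto simp: g_def s_def)
      then show ?thesis by auto
    next
      case 3
      then have "z \<notin> S"
        using ind[of z v] path dist by auto
      then have "g B \<in> S" "g B \<noteq> u" if "B \<in> P" for B
        using old[OF that] 3 uv dist by (auto simp: g_def s_def)
      then show ?thesis by auto
    qed
    have "indep (g ` P) (edges G)"
      unfolding indep_def
    proof (intro ballI impI)
      fix a b assume ab: "a \<in> g ` P" "b \<in> g ` P" "a \<noteq> b"
      then have "{a, b} \<noteq> {u, v}" "{a, b} \<notin> edges G'"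
        using sub ind[of a b] by auto
      then show "{a, b} \<notin> edges G"
        using edges by auto
    qed
    moreover have "g ` P \<subseteq> verts G"
      using g part by (auto simp: partition_on_def)
    ultimately have "independent_transversal G P (g ` P)"
      using g by (auto simp: independent_transversal_def independent_set_def)
    then show False
      using no_IT by blast
  qed
  ultimately show ?thesis
    by (auto simp: triple_partition_without_IT_def)
qed

section \<open>Lengthening one cycle of a disjoint union by three\<close>

abbreviation cycles_union :: "'i set \<Rightarrow> ('i \<Rightarrow> nat) \<Rightarrow> ('i \<times> nat) graph" where
  "cycles_union I l \<equiv> disjoint_union I (\<lambda>j. cycle_graph (l j))"

lemma verts_cycles_union: "verts (cycles_union I l) = (SIGMA j:I. {0..<l j})"
  by (simp add: disjoint_union_def verts_def cycle_graph_def)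

lemma edges_cycles_union:
  "edges (cycles_union I l) = {{(j, i), (j, (i + 1) mod l j)} | j i. j \<in> I \<and> i < l j}"
  unfolding disjoint_union_def edges_def cycle_graph_def by auto (metis image_insert image_empty)

lemma cycles_union_edgeI:
  "\<lbrakk>j \<in> I; i < l j; k = (i + 1) mod l j\<rbrakk> \<Longrightarrow> {(j, i), (j, k)} \<in> edges (cycles_union I l)"
  unfolding edges_cycles_union by blast

lemma cycles_union_cong: "(\<And>j. j \<in> I \<Longrightarrow> l j = l' j) \<Longrightarrow> cycles_union I l = cycles_union I l'"
  unfolding disjoint_union_def by (auto 4 4 cong: conj_cong Sigma_cong)

text \<open>The subdivided edge is the closing one, from \<open>l j - 1\<close> to \<open>0\<close>:
  the new vertices are then numbered \<open>l j\<close> to \<open>l j + 2\<close>, and no old vertex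
  is renumbered.\<close>

lemma triple_partition_without_IT_add3:
  fixes l :: "'i \<Rightarrow> nat"
  assumes "triple_partition_without_IT (cycles_union I l) P" and j: "j \<in> I" and l: "l j \<ge> 2"
  shows "\<exists>P'. triple_partition_without_IT (cycles_union I (l(j := l j + 3))) P'"
proof (rule triple_partition_without_IT_subdivide[OF assms(1)])
  let ?n = "l j" and ?l' = "l(j := l j + 3)"
  show "(j, ?n - 1) \<in> verts (cycles_union I l)" "(j, 0) \<in> verts (cycles_union I l)"
    using j l by (auto simp: verts_cycles_union)
  show "(j, ?n - 1) \<noteq> (j, 0)" "distinct [(j, ?n), (j, ?n + 1), (j, ?n + 2)]"
    using l by auto
  show "(j, ?n) \<notin> verts (cycles_union I l)" "(j, ?n + 1) \<notin> verts (cycles_union I l)"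
    "(j, ?n + 2) \<notin> verts (cycles_union I l)"
    by (auto simp: verts_cycles_union)
  show "verts (cycles_union I ?l') = verts (cycles_union I l) \<union> {(j, ?n), (j, ?n + 1), (j, ?n + 2)}"
    using j by (auto simp: verts_cycles_union split: if_splits)
  have "{(j, i), (j, i + 1)} \<in> edges (cycles_union I ?l')" if "i < ?n + 2" for i
    by (rule cycles_union_edgeI) (use j that in auto)
  from this[of "?n - 1"] this[of ?n] this[of "?n + 1"]
  have "{(j, ?n - 1), (j, ?n)} \<in> edges (cycles_union I ?l')"
    "{(j, ?n), (j, ?n + 1)} \<in> edges (cycles_union I ?l')"
    "{(j, ?n + 1), (j, ?n + 2)} \<in> edges (cycles_union I ?l')"
    using l by simp_all
  moreover have "{(j, ?n + 2), (j, 0)} \<in> edges (cycles_union I ?l')"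
    by (rule cycles_union_edgeI) (use j in \<open>simp_all add: numeral_eq_Suc\<close>)
  ultimately show "{{(j, ?n - 1), (j, ?n)}, {(j, ?n), (j, ?n + 1)}, {(j, ?n + 1), (j, ?n + 2)},
      {(j, ?n + 2), (j, 0)}} \<subseteq> edges (cycles_union I ?l')"
    by blast
  show "edges (cycles_union I l) - {{(j, ?n - 1), (j, 0)}} \<subseteq> edges (cycles_union I ?l')"
  proof
    fix e assume e: "e \<in> edges (cycles_union I l) - {{(j, ?n - 1), (j, 0)}}"
    then obtain k i where ki: "e = {(k, i), (k, (i + 1) mod l k)}" "k \<in> I" "i < l k"
      unfolding edges_cycles_union by auto
    show "e \<in> edges (cycles_union I ?l')"
    proof (cases "k = j")
      case True
      \<comment> \<open>Only the closing edge wraps around; for every other \<open>i\<close>,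
        reducing \<open>i + 1\<close> modulo the old or the new length changes nothing.\<close>
      have "i + 1 \<noteq> ?n"
      proof
        assume "i + 1 = ?n"
        then have "i = ?n - 1" "(i + 1) mod l j = 0" by auto
        then show False using e ki True by simp
      qed
      then show ?thesis
        using ki True by (auto intro!: cycles_union_edgeI)
    next
      case False
      then show ?thesis
        using ki by (auto intro!: cycles_union_edgeI)
    qed
  qed
qed

section \<open>The base case of three 4-cycles\<close>

lemma triple_partition_without_IT_three_4_cycles:
  "\<exists>P. triple_partition_without_IT (cycles_union {1..3 :: nat} (\<lambda>_. 4)) P"
proof -
  let ?G = "cycles_union {1..3 :: nat} (\<lambda>_. 4)"
  \<comment> \<open>Cycles 1 and 3 are split into opposite pairs; cycle 2 gives its vertices 0, 2 to
    the pairs of cycle 1 and 1, 3 to those of cycle 3.\<close>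
  define A B C D :: "(nat \<times> nat) set" where "A = {(1, 0), (1, 2), (2, 0)}"
    and "B = {(1, 1), (1, 3), (2, 2)}" and "C = {(3, 0), (3, 2), (2, 1)}"
    and "D = {(3, 1), (3, 3), (2, 3)}"
  note defs = A_def B_def C_def D_def
  have "verts ?G = {1, 2, 3} \<times> {0, 1, 2, 3}"
  proof -
    have "{1..3 :: nat} = {1, 2, 3}" "{0..<4 :: nat} = {0, 1, 2, 3}"
      by auto
    then show ?thesis
      by (simp add: verts_cycles_union)
  qed
  moreover have "\<Union> {A, B, C, D} = {1, 2, 3} \<times> {0, 1, 2, 3}"
    unfolding defs by (simp add: insert_Times_insert insert_commute)
  moreover have "disjoint {A, B, C, D}"
  proof -
    have "disjnt A B" "disjnt A C" "disjnt A D" "disjnt B C" "disjnt B D" "disjnt C D"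
      by (simp_all add: defs)
    then show ?thesis
      by (auto simp: pairwise_insert disjnt_sym)
  qed
  moreover have "{} \<notin> {A, B, C, D}"
    by (simp add: defs)
  ultimately have "partition_on (verts ?G) {A, B, C, D}"
    by (simp add: partition_on_def)
  moreover have "\<forall>X\<in>{A, B, C, D}. card X = 3"
    by (simp add: defs)
  moreover have "\<not> independent_transversal ?G {A, B, C, D} S" for S
  proof
    assume "independent_transversal ?G {A, B, C, D} S"
    then obtain f where f: "\<And>X. X \<in> {A, B, C, D} \<Longrightarrow> f X \<in> X"
      and S_eq: "S = f ` {A, B, C, D}"
      and ind: "\<And>a b. \<lbrakk>a \<in> S; b \<in> S; a \<noteq> b\<rbrakk> \<Longrightarrow> {a, b} \<notin> edges ?G"
      by (rule independent_transversalE) blast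
    have S: "f A \<in> S" "f B \<in> S" "f C \<in> S" "f D \<in> S"
      by (simp_all add: S_eq)
    have nonadj: "(j, i) \<notin> S \<or> (j, (i + 1) mod 4) \<notin> S" if "j \<in> {1..3}" "i < 4" for j i :: nat
    proof -
      have "i \<noteq> (i + 1) mod 4"
        using that(2) by presburger
      then show ?thesis
        using ind[of "(j, i)" "(j, (i + 1) mod 4)"]
          cycles_union_edgeI[of j "{1..3}" i "\<lambda>_. 4" "(i + 1) mod 4"] that by auto
    qed
    \<comment> \<open>In a 4-cycle each of 0, 2 is adjacent to each of 1, 3, so an independent set
      misses one of these pairs entirely.\<close>
    have alternate: "(j, 0) \<notin> S \<and> (j, 2) \<notin> S \<or> (j, 1) \<notin> S \<and> (j, 3) \<notin> S" if "j \<in> {1..3}" for j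
      using nonadj[OF that, of 0] nonadj[OF that, of 1] nonadj[OF that, of 2] nonadj[OF that, of 3]
      by (auto simp flip: numeral_2_eq_2)
    have "(1, 0) \<in> S \<or> (1, 2) \<in> S \<or> (2, 0) \<in> S"
      using f[of A] S(1) by (auto simp: A_def)
    moreover have "(1, 1) \<in> S \<or> (1, 3) \<in> S \<or> (2, 2) \<in> S"
      using f[of B] S(2) by (auto simp: B_def)
    moreover have "(3, 0) \<in> S \<or> (3, 2) \<in> S \<or> (2, 1) \<in> S"
      using f[of C] S(3) by (auto simp: C_def)
    moreover have "(3, 1) \<in> S \<or> (3, 3) \<in> S \<or> (2, 3) \<in> S"
      using f[of D] S(4) by (auto simp: D_def)
    \<comment> \<open>Cycle 1 forces one of \<open>(2, 0)\<close>, \<open>(2, 2)\<close> into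
      \<open>S\<close> and cycle 3 one of \<open>(2, 1)\<close>, \<open>(2, 3)\<close>, against
      \<open>alternate\<close> for cycle 2.\<close>
    moreover note alternate[of 1] alternate[of 2] alternate[of 3]
    ultimately show False
      by simp blast
  qed
  ultimately show ?thesis
    unfolding triple_partition_without_IT_def by blast
qed

section \<open>Induction on the cycle lengths\<close>

lemma triple_partition_without_IT_three_cycles:
  fixes k :: "nat \<Rightarrow> nat"
  shows "\<exists>P. triple_partition_without_IT (cycles_union {1..3} (\<lambda>j. 4 + 3 * k j)) P"
\<comment> \<open>The sum counts the subdivisions that lead from three 4-cycles to the given
  lengths; each induction step undoes one of them, in any cycle with \<open>k j > 0\<close>.\<close>
proof (induction "sum k {1..3}" arbitrary: k)
  case 0
  then have "cycles_union {1..3} (\<lambda>j. 4 + 3 * k j) = cycles_union {1..3} (\<lambda>_. 4)"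
    by (intro cycles_union_cong) auto
  then show ?case
    using triple_partition_without_IT_three_4_cycles by simp
next
  case (Suc n)
  then obtain j where j: "j \<in> {1..3}" "k j > 0"
    by (metis Zero_not_Suc not_gr_zero sum.neutral)
  define k' where "k' = k(j := k j - 1)"
  have "sum k {1..3} = k j + sum k ({1..3} - {j})" "sum k' {1..3} = k' j + sum k' ({1..3} - {j})"
    using j(1) by (simp_all add: sum.remove)
  moreover have "sum k' ({1..3} - {j}) = sum k ({1..3} - {j})"
    by (intro sum.cong) (auto simp: k'_def)
  ultimately have "n = sum k' {1..3}"
    using Suc(2) j(2) by (simp add: k'_def)
  then obtain P where "triple_partition_without_IT (cycles_union {1..3} (\<lambda>i. 4 + 3 * k' i)) P"
    using Suc(1) by blast
  then have "\<exists>P. triple_partition_without_IT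
      (cycles_union {1..3} ((\<lambda>i. 4 + 3 * k' i)(j := 4 + 3 * k' j + 3))) P"
    by (rule triple_partition_without_IT_add3) (use j in auto)
  moreover have "(\<lambda>i. 4 + 3 * k' i)(j := 4 + 3 * k' j + 3) = (\<lambda>i. 4 + 3 * k i)"
    using j(2) by (auto simp: k'_def fun_eq_iff)
  ultimately show ?case
    by (simp only:)
qed

theorem theorem4:
  fixes l :: "nat \<Rightarrow> nat" and G :: "(nat \<times> nat) graph"
  assumes "\<And>j. j \<in> {1..3} \<Longrightarrow> l j mod 3 = 1"
    and "\<And>j. j \<in> {1..3} \<Longrightarrow> l j \<ge> 4"
    and "G = disjoint_union {1..3} (\<lambda>j. cycle_graph (l j))"
  shows "\<exists>P. partition_on (verts G) P \<and> (\<forall>B\<in>P. card B = 3) \<and>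
             \<not> (\<exists>S. independent_transversal G P S)"
proof -
  have "l j = 4 + 3 * ((l j - 4) div 3)" if "j \<in> {1..3}" for j
    using assms(1,2)[OF that] by presburger
  then have "G = cycles_union {1..3} (\<lambda>j. 4 + 3 * ((l j - 4) div 3))"
    unfolding assms(3) by (rule cycles_union_cong)
  then show ?thesis
    using triple_partition_without_IT_three_cycles[of "\<lambda>j. (l j - 4) div 3"]
    by (simp add: triple_partition_without_IT_def)
qed

end
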